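(* Let $G$ be a finite group (not necessarily abelian), let $k\geq 2$, and let $n_1,\dots,n_k$ be non-zero integers with $n_1+\dots+n_k=0$, each coprime to $|G|$. Let $A\subset G$ be a subset such that whenever $g_1,\dots,g_k\in A$ satisfy $g_1^{n_1}g_2^{n_2}\cdots g_k^{n_k}=1$, one has $g_1=g_2=\dots=g_k$. Let $\mathbb{F}$ be a field and let $X_1,\dots,X_k$ be linear subspaces of the group algebra $\mathbb{F}[G]$ such that $X_1X_2\cdots X_k=0$. Put $t_i=\operatorname{codim} X_i$. Call two indices $i,j\in\{1,\dots,k\}$ equivalent if $X_i=X_j$ and $n_i=n_j$, and let $I\subset\{1,\dots,k\}$ be a maximal system of mutually non-equivalent indices. Then $$|A|\leq \begin{cases}\sum_{i\in I} t_i & \text{if } |I|\geq 2,\\ 2t_1 & \text{if } |I|=1.\end{cases}$$ In particular, one always has $|A|\leq \sum_{i=1}^k t_i$.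
   Context: $X_1X_2\cdots X_k=0$ means that $u_1u_2\cdots u_k=0$ in $\mathbb{F}[G]$ for all $u_i\in X_i$, $i=1,\dots,k$. Codimensions are taken in $\mathbb{F}[G]$, so $t_i=|G|-\dim_{\mathbb{F}} X_i$. *)

theory Defs
  imports Complex_Main "HOL-Algebra.Ring" "HOL-Algebra.Coset" "HOL-Library.Function_Algebras"
begin

text \<open>Ordered product of a list in a (not necessarily commutative) monoid; it is used both for
  \<open>G\<close> and for the multiplicative structure of \<open>F[G]\<close>.\<close>

definition list_prod :: "('a, 'm) monoid_scheme \<Rightarrow> 'a list \<Rightarrow> 'a" where
  "list_prod M xs = foldr (\<otimes>\<^bsub>M\<^esub>) xs \<one>\<^bsub>M\<^esub>"

text \<open>An element of the group algebra of a finite group is the function giving its coefficients,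
  extended by zero outside of the carrier.\<close>

definition group_algebra :: "('g, 'm) monoid_scheme \<Rightarrow> ('g \<Rightarrow> 'f::field) ring" where
  "group_algebra G =
    \<lparr> carrier = {u. \<forall>x. x \<notin> carrier G \<longrightarrow> u x = 0},
      mult = (\<lambda>u v x. \<Sum>(y, z) \<in> {(y, z). y \<in> carrier G \<and> z \<in> carrier G \<and> y \<otimes>\<^bsub>G\<^esub> z = x}. u y * v z),
      one = (\<lambda>x. if x = \<one>\<^bsub>G\<^esub> then 1 else 0),
      zero = (\<lambda>x. 0),
      add = (\<lambda>u v x. u x + v x) \<rparr>"

definition fscale :: "'f::field \<Rightarrow> ('g \<Rightarrow> 'f) \<Rightarrow> 'g \<Rightarrow> 'f" where
  "fscale c u = (\<lambda>x. c * u x)"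

global_interpretation func: vector_space "fscale :: 'f::field \<Rightarrow> ('g \<Rightarrow> 'f) \<Rightarrow> 'g \<Rightarrow> 'f"
  by unfold_locales (auto simp: fscale_def fun_eq_iff algebra_simps)

definition group_algebra_subspace :: "('g, 'm) monoid_scheme \<Rightarrow> ('g \<Rightarrow> 'f::field) set \<Rightarrow> bool" where
  "group_algebra_subspace G X \<longleftrightarrow> X \<subseteq> carrier (group_algebra G) \<and> func.subspace X"

text \<open>Integer-valued, so that the subtraction is not truncated.\<close>

definition codim :: "('g, 'm) monoid_scheme \<Rightarrow> ('g \<Rightarrow> 'f::field) set \<Rightarrow> int" where
  "codim G X = int (order G) - int (func.dim X)"

definition product_vanishes ::
    "('g, 'm) monoid_scheme \<Rightarrow> nat \<Rightarrow> (nat \<Rightarrow> ('g \<Rightarrow> 'f::field) set) \<Rightarrow> bool" where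
  "product_vanishes G k X \<longleftrightarrow>
    (\<forall>u. (\<forall>i\<in>{1..k}. u i \<in> X i) \<longrightarrow>
      list_prod (group_algebra G) (map u [1..<Suc k]) = \<zero>\<^bsub>group_algebra G\<^esub>)"

definition index_equiv :: "(nat \<Rightarrow> 'x set) \<Rightarrow> (nat \<Rightarrow> int) \<Rightarrow> nat \<Rightarrow> nat \<Rightarrow> bool" where
  "index_equiv X n i j \<longleftrightarrow> X i = X j \<and> n i = n j"

definition nonequiv_system :: "nat \<Rightarrow> (nat \<Rightarrow> 'x set) \<Rightarrow> (nat \<Rightarrow> int) \<Rightarrow> nat set \<Rightarrow> bool" where
  "nonequiv_system k X n I \<longleftrightarrow>
    I \<subseteq> {1..k} \<and> (\<forall>i\<in>I. \<forall>j\<in>I. i \<noteq> j \<longrightarrow> \<not> index_equiv X n i j)"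

definition maximal_nonequiv_system :: "nat \<Rightarrow> (nat \<Rightarrow> 'x set) \<Rightarrow> (nat \<Rightarrow> int) \<Rightarrow> nat set \<Rightarrow> bool" where
  "maximal_nonequiv_system k X n I \<longleftrightarrow>
    nonequiv_system k X n I \<and> (\<forall>J. nonequiv_system k X n J \<and> I \<subseteq> J \<longrightarrow> J = I)"

end

theory Submission imports Defs "HOL-Algebra.Multiplicative_Group" begin

text \<open>Let \<open>Y\<^sub>i\<close> consist of the functions \<open>g \<mapsto> u (g ^ n\<^sub>i)\<close> on \<open>A\<close>, where \<open>u\<close> ranges over the elements of
  \<open>X\<^sub>i\<close> supported on the \<open>n\<^sub>i\<close>-th powers of elements of \<open>A\<close>. As powering by \<open>n\<^sub>i\<close> permutes \<open>G\<close>,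
  the codimension of \<open>Y\<^sub>i\<close> in \<open>F\<^sup>A\<close> is at most \<open>t\<^sub>i\<close>. The hypothesis on \<open>A\<close> turns the
  coefficient of \<open>1\<close> in a product of elements of the \<open>X\<^sub>i\<close> into the diagonal sum
  \<open>\<Sum>a\<in>A. \<Prod>i. f\<^sub>i a\<close>, so this form vanishes on \<open>Y\<^sub>1 \<times> \<dots> \<times> Y\<^sub>k\<close>.

  Write \<open>c\<^sub>S Y\<close> for the codimension of the restriction of \<open>Y\<close> to \<open>S\<close>. If \<open>f \<in> Y\<^sub>j\<close> has
  maximal support \<open>T\<close> within \<open>S\<close>, then \<open>Y\<^sub>j\<close> has the same dimension on \<open>T\<close> as on \<open>S\<close>, so
  \<open>c Y\<^sub>j\<close> drops by \<open>\<bar>S\<bar> - \<bar>T\<bar>\<close> and \<open>\<bar>S\<bar> - (\<Sum>i\<in>I. c\<^sub>S Y\<^sub>i)\<close> does not decrease when \<open>S\<close> is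
  replaced by \<open>T\<close>. This is done for all indices except two elements \<open>p, q\<close> of \<open>I\<close>. On the
  remaining set \<open>T\<close> the spaces \<open>Y\<^sub>p\<close> and \<open>Y\<^sub>q\<close> are orthogonal for a weight without zeros, whence
  \<open>c\<^sub>T Y\<^sub>p + c\<^sub>T Y\<^sub>q \<ge> \<bar>T\<bar>\<close>. Only representatives of the classes enter \<open>I\<close>, except that
  \<open>I = {1, 2}\<close> if there is a single class.\<close>

section \<open>Dimensions of spaces of finitely supported functions\<close>

definition restr :: "'a set \<Rightarrow> ('a \<Rightarrow> 'f::field) \<Rightarrow> 'a \<Rightarrow> 'f" where
  "restr T f = (\<lambda>x. if x \<in> T then f x else 0)"

lemma restr_apply: "restr T f x = (if x \<in> T then f x else 0)"
  by (simp add: restr_def)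

lemma linear_funcI:
  fixes \<phi> :: "('a \<Rightarrow> 'f::field) \<Rightarrow> 'b \<Rightarrow> 'f"
  assumes "\<And>u v. \<phi> (u + v) = \<phi> u + \<phi> v" "\<And>c u. \<phi> (fscale c u) = fscale c (\<phi> u)"
  shows "Vector_Spaces.linear fscale fscale \<phi>"
  using assms by unfold_locales auto

lemma linear_restr: "Vector_Spaces.linear fscale fscale (restr T)"
  by (rule linear_funcI) (auto simp: restr_def fscale_def fun_eq_iff)

lemma func_subspace_image:
  fixes \<phi> :: "('a \<Rightarrow> 'f::field) \<Rightarrow> 'b \<Rightarrow> 'f"
  assumes "Vector_Spaces.linear fscale fscale \<phi>" "func.subspace V"
  shows "func.subspace (\<phi> ` V)"
proof -
  interpret l: Vector_Spaces.linear fscale fscale \<phi> by fact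
  show ?thesis using assms(2) by (rule l.subspace_image)
qed

lemma sum_fun_apply: "(\<Sum>i\<in>I. f i) x = (\<Sum>i\<in>I. f i x)"
  for f :: "'i \<Rightarrow> 'a \<Rightarrow> 'b::comm_monoid_add"
  by (induction I rule: infinite_finite_induct) auto

lemma in_span_deltas:
  fixes f :: "'a \<Rightarrow> 'f::field"
  assumes "finite S" "\<And>x. x \<notin> S \<Longrightarrow> f x = 0"
  shows "f \<in> func.span ((\<lambda>s x. if x = s then 1 else 0) ` S)"
proof -
  have "(\<Sum>s\<in>S. fscale (f s) (\<lambda>x. if x = s then 1 else 0)) x = f x" for x
    using assms by (simp add: sum_fun_apply fscale_def if_distrib cong: if_cong)
  then have "f = (\<Sum>s\<in>S. fscale (f s) (\<lambda>x. if x = s then 1 else 0))"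
    by (simp add: fun_eq_iff)
  also have "\<dots> \<in> func.span ((\<lambda>s x. if x = s then 1 else 0) ` S)"
    by (intro func.span_sum func.span_scale func.span_base imageI)
  finally show ?thesis .
qed

lemma func_dim_le_card:
  fixes V :: "('a \<Rightarrow> 'f::field) set"
  assumes "finite S" "\<And>f x. f \<in> V \<Longrightarrow> x \<notin> S \<Longrightarrow> f x = 0"
  shows "func.dim V \<le> card S"
proof -
  have "V \<subseteq> func.span ((\<lambda>s x. if x = s then 1 else 0) ` S)"
    using in_span_deltas assms by blast
  then have "func.dim V \<le> card ((\<lambda>s x. if x = s then 1 else (0::'f)) ` S)"
    using assms by (intro func.dim_le_card) auto
  also have "\<dots> \<le> card S" using assms by (simp add: card_image_le)
  finally show ?thesis .
qed

lemma func_dim_eq_0: "(\<And>v. v \<in> V \<Longrightarrow> v = 0) \<Longrightarrow> func.dim V = 0"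
  using func_dim_le_card[of "{}" V] by fastforce

text \<open>The space of all functions may be infinite-dimensional. Common finite support puts
  \<open>V\<close> into the span of finitely many delta functions, and an independent set there is
  finite.\<close>

lemma func_finite_basis:
  fixes V :: "('a \<Rightarrow> 'f::field) set"
  assumes "finite S" "\<And>f x. f \<in> V \<Longrightarrow> x \<notin> S \<Longrightarrow> f x = 0"
  obtains B where "B \<subseteq> V" "finite B" "V \<subseteq> func.span B" "card B = func.dim V"
proof -
  obtain B where B: "B \<subseteq> V" "func.independent B" "V \<subseteq> func.span B" "card B = func.dim V"
    using func.basis_exists by blast
  have "B \<subseteq> func.span ((\<lambda>s x. if x = s then 1 else 0) ` S)"
    using in_span_deltas assms B by blast
  then have "finite B"
    using func.independent_span_bound[OF _ B(2)] assms by blast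
  with B that show ?thesis by blast
qed

text \<open>The inequality half of rank-nullity. \<open>D\<close> lifts a minimal spanning set of
  the image to \<open>V\<close>; subtracting from \<open>v\<close> a combination of \<open>D\<close>
  with the same image leaves an element of the kernel. \<open>S\<close> and \<open>S'\<close>
  guarantee finite spanning sets.\<close>

lemma func_dim_le_image_plus_kernel:
  fixes V :: "('a \<Rightarrow> 'f::field) set" and \<phi> :: "('a \<Rightarrow> 'f) \<Rightarrow> 'b \<Rightarrow> 'f"
  assumes lin: "Vector_Spaces.linear fscale fscale \<phi>" and V: "func.subspace V"
    and S: "finite S" "\<And>f x. f \<in> V \<Longrightarrow> x \<notin> S \<Longrightarrow> f x = 0"
    and S': "finite S'" "\<And>f x. f \<in> V \<Longrightarrow> x \<notin> S' \<Longrightarrow> \<phi> f x = 0"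
  shows "func.dim V \<le> func.dim (\<phi> ` V) + func.dim {v \<in> V. \<phi> v = 0}"
proof -
  interpret l: Vector_Spaces.linear fscale fscale \<phi> by fact
  let ?N = "{v \<in> V. \<phi> v = 0}"
  obtain B where B: "B \<subseteq> ?N" "finite B" "?N \<subseteq> func.span B" "card B = func.dim ?N"
    using func_finite_basis[of S ?N] S by auto
  obtain C where C: "C \<subseteq> \<phi> ` V" "finite C" "\<phi> ` V \<subseteq> func.span C" "card C = func.dim (\<phi> ` V)"
    using func_finite_basis[of S' "\<phi> ` V"] S' by auto
  obtain D where D: "D \<subseteq> V" "finite D" "C = \<phi> ` D" "card D = card C"
    using C(1,2) by (metis subset_image_inj card_image finite_imageD)
  have "V \<subseteq> func.span (B \<union> D)"
  proof
    fix v assume v: "v \<in> V"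
    then have "\<phi> v \<in> \<phi> ` func.span D" using C(3) D(3) l.span_image by auto
    then obtain w where w: "w \<in> func.span D" "\<phi> v = \<phi> w" by auto
    have "w \<in> V" using w(1) D(1) V func.span_minimal by blast
    then have "v - w \<in> ?N" using v V w by (auto simp: l.diff func.subspace_diff)
    then have "v - w \<in> func.span (B \<union> D)" using B(3) func.span_mono[of B "B \<union> D"] by auto
    moreover have "w \<in> func.span (B \<union> D)" using w(1) func.span_mono[of D "B \<union> D"] by auto
    ultimately have "(v - w) + w \<in> func.span (B \<union> D)" by (rule func.span_add)
    then show "v \<in> func.span (B \<union> D)" by simp
  qed
  then have "func.dim V \<le> card (B \<union> D)" using B(2) D(2) by (intro func.dim_le_card) auto
  also have "\<dots> \<le> card B + card D" by (rule card_Un_le)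
  finally show ?thesis using B C D by simp
qed

section \<open>Dimension under restriction to a set of coordinates\<close>

definition rdim :: "'a set \<Rightarrow> ('a \<Rightarrow> 'f::field) set \<Rightarrow> nat" where
  "rdim T Y = func.dim (restr T ` Y)"

text \<open>Source of two comparisons: the kernel of restricting further to \<open>T\<close> lives
  on \<open>S - T\<close>, and it is zero if \<open>T\<close> determines the functions on
  \<open>S\<close>.\<close>

lemma rdim_le_plus_kernel:
  fixes Y :: "('a \<Rightarrow> 'f::field) set"
  assumes "func.subspace Y" "finite S" "T \<subseteq> S"
  shows "rdim S Y \<le> rdim T Y + func.dim {v \<in> restr S ` Y. restr T v = 0}"
proof -
  have "restr T ` restr S ` Y = restr T ` Y"
    using assms(3) by (force simp: image_image restr_def subset_iff cong: if_cong)
  then show ?thesis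
    using func_dim_le_image_plus_kernel[OF linear_restr func_subspace_image[OF linear_restr assms(1)],
        of S S T T] assms finite_subset
    by (fastforce simp: rdim_def restr_apply)
qed

lemma rdim_le_plus_card_Diff:
  fixes Y :: "('a \<Rightarrow> 'f::field) set"
  assumes "func.subspace Y" "finite S" "T \<subseteq> S"
  shows "rdim S Y \<le> rdim T Y + card (S - T)"
proof -
  have "func.dim {v \<in> restr S ` Y. restr T v = 0} \<le> card (S - T)"
    using assms by (intro func_dim_le_card) (auto simp: restr_def fun_eq_iff split: if_splits)
  then show ?thesis using rdim_le_plus_kernel[OF assms] by simp
qed

lemma rdim_le_if_inj:
  fixes Y :: "('a \<Rightarrow> 'f::field) set"
  assumes "func.subspace Y" "finite S" "T \<subseteq> S"
    and "\<And>y. y \<in> Y \<Longrightarrow> \<forall>x\<in>T. y x = 0 \<Longrightarrow> \<forall>x\<in>S. y x = 0"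
  shows "rdim S Y \<le> rdim T Y"
proof -
  have "v = 0" if v: "v \<in> restr S ` Y" "restr T v = 0" for v
  proof -
    obtain y where y: "y \<in> Y" "v = restr S y" using v by auto
    have "\<forall>x\<in>T. y x = 0"
      using v(2) y(2) assms(3) by (auto simp: restr_def fun_eq_iff subset_iff split: if_splits)
    then show ?thesis using assms(4) y by (auto simp: restr_def)
  qed
  then have "func.dim {v \<in> restr S ` Y. restr T v = 0} = 0" by (intro func_dim_eq_0) blast
  then show ?thesis using rdim_le_plus_kernel[OF assms(1-3)] by simp
qed

lemma rdim_le_card: "finite T \<Longrightarrow> rdim T Y \<le> card T"
  unfolding rdim_def by (intro func_dim_le_card) (auto simp: restr_def)

text \<open>Take \<open>f\<close> with largest support in \<open>S\<close>. If some \<open>y\<close>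
  vanished on that support but not on \<open>S\<close>, then \<open>f + y\<close> would keep every
  point of the support and gain another.\<close>

lemma max_support:
  fixes Y :: "('a \<Rightarrow> 'f::field) set"
  assumes "func.subspace Y" "finite S"
  shows "\<exists>f\<in>Y. \<forall>y\<in>Y. (\<forall>x\<in>{x\<in>S. f x \<noteq> 0}. y x = 0) \<longrightarrow> (\<forall>x\<in>S. y x = 0)"
proof -
  let ?c = "\<lambda>f. card {x\<in>S. f x \<noteq> (0::'f)}"
  have "\<exists>f. f \<in> Y \<and> (\<forall>y. y \<in> Y \<longrightarrow> ?c y \<le> ?c f)"
    using assms by (intro ex_has_greatest_nat[of _ 0 _ "Suc (card S)"])
      (auto simp: func.subspace_0 less_Suc_eq_le intro!: card_mono)
  then obtain f where f: "f \<in> Y" "\<And>y. y \<in> Y \<Longrightarrow> ?c y \<le> ?c f" by blast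
  have "y x = 0" if y: "y \<in> Y" "\<forall>x\<in>{x\<in>S. f x \<noteq> 0}. y x = 0" and x: "x \<in> S" for y x
  proof (rule ccontr)
    assume "y x \<noteq> 0"
    with y(2) x have "x \<in> {x\<in>S. (f + y) x \<noteq> 0} - {x\<in>S. f x \<noteq> 0}" by auto
    moreover have "{x\<in>S. f x \<noteq> 0} \<subseteq> {x\<in>S. (f + y) x \<noteq> 0}" using y(2) by auto
    ultimately have "{x\<in>S. f x \<noteq> 0} \<subset> {x\<in>S. (f + y) x \<noteq> 0}" by blast
    then have "?c f < ?c (f + y)" using assms(2) by (intro psubset_card_mono) auto
    moreover have "f + y \<in> Y" using f y assms(1) by (intro func.subspace_add)
    ultimately show False using f(2)[of "f + y"] by simp
  qed
  with f(1) show ?thesis by blast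
qed

text \<open>\<open>P\<close> is an information set in the sense of linear codes: determining the
  values on \<open>T\<close> makes it large, and minimality yields for each of its points an element
  isolating that point within \<open>P\<close>.\<close>

lemma information_set:
  fixes U :: "('a \<Rightarrow> 'f::field) set"
  assumes U: "func.subspace U" and T: "finite T"
  obtains P where "P \<subseteq> T" "rdim T U \<le> card P"
    "\<And>p. p \<in> P \<Longrightarrow> \<exists>u\<in>U. u p \<noteq> 0 \<and> (\<forall>x\<in>P - {p}. u x = 0)"
proof -
  let ?inj = "\<lambda>P. P \<subseteq> T \<and> (\<forall>y\<in>U. (\<forall>x\<in>P. y x = 0) \<longrightarrow> (\<forall>x\<in>T. y x = 0))"
  \<comment> \<open>A smallest set of coordinates that determines the elements of \<open>U\<close> on \<open>T\<close>.\<close>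
  define P where "P = arg_min card ?inj"
  have P: "?inj P" "\<And>Q. ?inj Q \<Longrightarrow> card P \<le> card Q"
    unfolding P_def by (rule arg_min_natI[of ?inj T], blast) (rule arg_min_nat_le)
  have fP: "finite P" using P(1) T finite_subset by blast
  have "rdim T U \<le> rdim P U" using P(1) by (intro rdim_le_if_inj U T) auto
  also have "\<dots> \<le> card P" using fP by (rule rdim_le_card)
  finally have *: "rdim T U \<le> card P" .
  have "\<exists>u\<in>U. u p \<noteq> 0 \<and> (\<forall>x\<in>P - {p}. u x = 0)" if p: "p \<in> P" for p
  proof -
    have "card (P - {p}) < card P" using fP p by (rule card_Diff1_less)
    then have "\<not> ?inj (P - {p})" using P(2) leD by blast
    \<comment> \<open>Since \<open>P\<close> does determine the values on \<open>T\<close>, this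
      \<open>u\<close> cannot vanish on all of \<open>P\<close>, so \<open>u p\<close> is
      non-zero.\<close>
    then obtain u where "u \<in> U" "\<forall>x\<in>P - {p}. u x = 0" "\<not> (\<forall>x\<in>T. u x = 0)"
      using P(1) by blast
    then show ?thesis using P(1) by blast
  qed
  with * P(1) that show ?thesis by blast
qed

text \<open>Let \<open>P\<close> be an information set for \<open>U\<close>. If \<open>v\<close>
  vanishes on \<open>T - P\<close>, testing it against the element isolating \<open>x\<close> leaves
  the single term \<open>w x * u x * v x\<close>, so \<open>v x = 0\<close>. Hence
  \<open>T - P\<close> determines \<open>V\<close> on \<open>T\<close>.\<close>

lemma rdim_add_le_card_if_orthogonal:
  fixes U V :: "('a \<Rightarrow> 'f::field) set"
  assumes U: "func.subspace U" and V: "func.subspace V" and T: "finite T"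
    and w: "\<And>x. x \<in> T \<Longrightarrow> w x \<noteq> 0"
    and orth: "\<And>u v. u \<in> U \<Longrightarrow> v \<in> V \<Longrightarrow> (\<Sum>x\<in>T. w x * u x * v x) = 0"
  shows "rdim T U + rdim T V \<le> card T"
proof -
  obtain P where P: "P \<subseteq> T" "rdim T U \<le> card P"
    "\<And>p. p \<in> P \<Longrightarrow> \<exists>u\<in>U. u p \<noteq> 0 \<and> (\<forall>x\<in>P - {p}. u x = 0)"
    using information_set[OF U T] by metis
  have "v x = 0" if v: "v \<in> V" "\<forall>x\<in>T - P. v x = 0" and x: "x \<in> T" for v x
  proof (cases "x \<in> P")
    case True
    then obtain u where u: "u \<in> U" "u x \<noteq> 0" "\<forall>z\<in>P - {x}. u z = 0" using P(3) by blast
    have "0 = (\<Sum>z\<in>T. w z * u z * v z)" using orth u(1) v(1) by simp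
    also have "\<dots> = (\<Sum>z\<in>{x}. w z * u z * v z)"
      using T x u v by (intro sum.mono_neutral_right) auto
    finally show ?thesis using u w x by simp
  qed (use v x in blast)
  then have "rdim T V \<le> rdim (T - P) V" by (intro rdim_le_if_inj V T) auto
  also have "\<dots> \<le> card (T - P)" using T by (intro rdim_le_card) auto
  also have "\<dots> = card T - card P" using T P(1) by (meson card_Diff_subset finite_subset)
  finally show ?thesis using P(2) card_mono[OF T P(1)] by linarith
qed

section \<open>Shrinking the ground set without lowering the potential\<close>

definition rcodim :: "'a set \<Rightarrow> ('a \<Rightarrow> 'f::field) set \<Rightarrow> int" where
  "rcodim T Y = int (card T) - int (rdim T Y)"

lemma rcodim_nonneg: "finite T \<Longrightarrow> 0 \<le> rcodim T Y"
  using rdim_le_card[of T Y] by (simp add: rcodim_def)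

lemma rcodim_mono:
  assumes "func.subspace Y" "finite S" "T \<subseteq> S"
  shows "rcodim T Y \<le> rcodim S Y"
  using rdim_le_plus_card_Diff[OF assms] card_mono[OF assms(2,3)]
    card_Diff_subset[OF finite_subset[OF assms(3,2)] assms(3)]
  by (simp add: rcodim_def)

text \<open>On the support of an \<open>f\<close> of maximal support, \<open>Y j\<close> keeps its
  dimension, so its codimension falls by exactly the number of points lost. The other codimensions
  can only fall as well.\<close>

lemma potential_step:
  fixes Y :: "'i \<Rightarrow> ('a \<Rightarrow> 'f::field) set"
  assumes S: "finite S" and I: "finite I" "j \<in> I"
    and Y: "\<And>i. i \<in> I \<Longrightarrow> func.subspace (Y i)"
  obtains f where "f \<in> Y j"
    "int (card S) - (\<Sum>i\<in>I. rcodim S (Y i))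
      \<le> int (card {x\<in>S. f x \<noteq> 0}) - (\<Sum>i\<in>I. rcodim {x\<in>S. f x \<noteq> 0} (Y i))"
proof -
  obtain f where f: "f \<in> Y j"
    "\<forall>y\<in>Y j. (\<forall>x\<in>{x\<in>S. f x \<noteq> 0}. y x = 0) \<longrightarrow> (\<forall>x\<in>S. y x = 0)"
    using max_support[OF Y[OF I(2)] S] by blast
  let ?T = "{x\<in>S. f x \<noteq> 0}"
  have "rdim S (Y j) \<le> rdim ?T (Y j)"
    using f(2) by (intro rdim_le_if_inj Y I S) blast+
  then have "rcodim ?T (Y j) + int (card S) \<le> rcodim S (Y j) + int (card ?T)"
    by (simp add: rcodim_def)
  moreover have "(\<Sum>i\<in>I - {j}. rcodim ?T (Y i)) \<le> (\<Sum>i\<in>I - {j}. rcodim S (Y i))"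
    using Y S by (intro sum_mono rcodim_mono) auto
  ultimately show ?thesis
    using that f(1) sum.remove[OF I, of "\<lambda>i. rcodim ?T (Y i)"]
      sum.remove[OF I, of "\<lambda>i. rcodim S (Y i)"] by simp
qed

text \<open>Iterates \<open>potential_step\<close>, each time inside the common support of the
  functions already chosen. \<open>J\<close> may contain indices outside \<open>I\<close>; for these
  the step is applied to a representative, whose space is the same.\<close>

lemma potential_le:
  fixes Y :: "'i \<Rightarrow> ('a \<Rightarrow> 'f::field) set"
  assumes A: "finite A" and I: "finite I"
    and Y: "\<And>i. i \<in> I \<Longrightarrow> func.subspace (Y i)"
    and J: "finite J" "\<And>i. i \<in> J \<Longrightarrow> \<exists>j\<in>I. Y i = Y j"
  shows "\<exists>f. (\<forall>i\<in>J. f i \<in> Y i) \<and>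
    int (card A) - (\<Sum>i\<in>I. rcodim A (Y i))
      \<le> int (card {x\<in>A. \<forall>i\<in>J. f i x \<noteq> 0})
        - (\<Sum>i\<in>I. rcodim {x\<in>A. \<forall>i\<in>J. f i x \<noteq> 0} (Y i))"
  using J
proof (induction J rule: finite_induct)
  case empty
  then show ?case by simp
next
  case (insert j J)
  then obtain f where f: "\<forall>i\<in>J. f i \<in> Y i"
    "int (card A) - (\<Sum>i\<in>I. rcodim A (Y i))
      \<le> int (card {x\<in>A. \<forall>i\<in>J. f i x \<noteq> 0})
        - (\<Sum>i\<in>I. rcodim {x\<in>A. \<forall>i\<in>J. f i x \<noteq> 0} (Y i))" by auto
  let ?S = "{x\<in>A. \<forall>i\<in>J. f i x \<noteq> 0}"
  obtain j' where j': "j' \<in> I" "Y j = Y j'" using insert.prems by blast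
  obtain h where h: "h \<in> Y j'"
    "int (card ?S) - (\<Sum>i\<in>I. rcodim ?S (Y i))
      \<le> int (card {x\<in>?S. h x \<noteq> 0}) - (\<Sum>i\<in>I. rcodim {x\<in>?S. h x \<noteq> 0} (Y i))"
    using potential_step[of ?S I j' Y] A I Y j' by auto
  have "{x\<in>?S. h x \<noteq> 0} = {x\<in>A. \<forall>i\<in>insert j J. (f(j := h)) i x \<noteq> 0}"
    using insert.hyps by auto
  with f h j' insert.hyps show ?case by (intro exI[of _ "f(j := h)"]) auto
qed

text \<open>Fixing functions for all indices but \<open>p\<close> and \<open>q\<close> leaves a
  bilinear form on the common support \<open>?T\<close>, weighted by their product. Both
  \<open>p\<close> and \<open>q\<close> must lie in \<open>I\<close>, as both codimensions are
  needed to reach \<open>card ?T\<close>.\<close>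

lemma card_le_sum_rcodim:
  fixes Y :: "'i \<Rightarrow> ('a \<Rightarrow> 'f::field) set"
  assumes A: "finite A" and K: "finite K" "I \<subseteq> K"
    and Y: "\<And>i. i \<in> K \<Longrightarrow> func.subspace (Y i)"
    and I: "\<And>i. i \<in> K \<Longrightarrow> \<exists>j\<in>I. Y i = Y j"
    and pq: "p \<in> I" "q \<in> I" "p \<noteq> q"
    and vanish: "\<And>f. (\<And>i. i \<in> K \<Longrightarrow> f i \<in> Y i) \<Longrightarrow> (\<Sum>a\<in>A. \<Prod>i\<in>K. f i a) = 0"
  shows "int (card A) \<le> (\<Sum>i\<in>I. rcodim A (Y i))"
proof -
  have fI: "finite I" using K finite_subset by blast
  let ?J = "K - {p, q}"
  obtain f where f: "\<And>i. i \<in> ?J \<Longrightarrow> f i \<in> Y i" and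
    le: "int (card A) - (\<Sum>i\<in>I. rcodim A (Y i))
      \<le> int (card {x\<in>A. \<forall>i\<in>?J. f i x \<noteq> 0})
        - (\<Sum>i\<in>I. rcodim {x\<in>A. \<forall>i\<in>?J. f i x \<noteq> 0} (Y i))"
    using potential_le[of A I Y ?J] A fI Y I K by blast
  let ?T = "{x\<in>A. \<forall>i\<in>?J. f i x \<noteq> 0}"
  have T: "finite ?T" using A by simp
  have KJ: "K = insert p (insert q ?J)" using pq K by auto
  have "(\<Sum>x\<in>?T. (\<Prod>i\<in>?J. f i x) * y x * z x) = 0" if "y \<in> Y p" "z \<in> Y q" for y z
  proof -
    let ?f = "f(p := y, q := z)"
    have prod: "(\<Prod>i\<in>K. ?f i x) = (\<Prod>i\<in>?J. f i x) * y x * z x" for x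
    proof -
      have "(\<Prod>i\<in>K. ?f i x) = (\<Prod>i\<in>insert p (insert q ?J). ?f i x)"
        by (rule prod.cong[OF KJ refl])
      also have "\<dots> = y x * (z x * (\<Prod>i\<in>?J. ?f i x))" using pq K(1) by simp
      also have "(\<Prod>i\<in>?J. ?f i x) = (\<Prod>i\<in>?J. f i x)" by (intro prod.cong) auto
      finally show ?thesis by (simp only: mult_ac)
    qed
    have "0 = (\<Sum>x\<in>A. \<Prod>i\<in>K. ?f i x)"
      by (rule vanish[symmetric]) (use that f pq in auto)
    \<comment> \<open>Off \<open>?T\<close> one of the fixed factors vanishes.\<close>
    also have "\<dots> = (\<Sum>x\<in>?T. (\<Prod>i\<in>?J. f i x) * y x * z x)"
      unfolding prod using A K(1) by (intro sum.mono_neutral_right) auto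
    finally show ?thesis by simp
  qed
  then have "rdim ?T (Y p) + rdim ?T (Y q) \<le> card ?T"
    using pq K Y T
    by (intro rdim_add_le_card_if_orthogonal[where w = "\<lambda>x. \<Prod>i\<in>?J. f i x"]) auto
  \<comment> \<open>The two codimensions add up to twice \<open>card ?T\<close> minus the two
    dimensions. Hence the potential is at most 0 on \<open>?T\<close>, and so also on
    \<open>A\<close>.\<close>
  then have "int (card ?T) \<le> (\<Sum>i\<in>{p, q}. rcodim ?T (Y i))"
    using pq by (simp add: rcodim_def)
  also have "\<dots> \<le> (\<Sum>i\<in>I. rcodim ?T (Y i))"
    using fI pq rcodim_nonneg[OF T] by (intro sum_mono2) auto
  finally show ?thesis using le by linarith
qed


section \<open>Power maps and coefficients of products in the group algebra\<close>

lemma list_prod_simps [simp]: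
  "list_prod M [] = \<one>\<^bsub>M\<^esub>"
  "list_prod M (x # xs) = x \<otimes>\<^bsub>M\<^esub> list_prod M xs"
  by (simp_all add: list_prod_def)

context group
begin

lemma list_prod_closed:
  "(\<And>x. x \<in> set xs \<Longrightarrow> x \<in> carrier G) \<Longrightarrow> list_prod G xs \<in> carrier G"
  by (induction xs) auto

lemma list_prod_int_pow:
  "a \<in> carrier G \<Longrightarrow> list_prod G (map (\<lambda>i. a [^] (n i :: int)) js) = a [^] (\<Sum>i\<leftarrow>js. n i)"
  by (induction js) (auto simp: int_pow_mult)

text \<open>With the Bezout relation \<open>m * n + l * order G = 1\<close>, raising to the power
  \<open>m\<close> undoes raising to the power \<open>n\<close>. An injective self-map of a finite
  set is onto.\<close>

lemma bij_betw_int_pow: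
  assumes fin: "finite (carrier G)" and cop: "coprime (n::int) (int (order G))"
  shows "bij_betw (\<lambda>g. g [^] n) (carrier G) (carrier G)"
proof -
  obtain m l where ml: "m * n + l * int (order G) = 1"
    using cop bezout_int[of n "int (order G)"] by auto
  have "(g [^] n) [^] m = g" if g: "g \<in> carrier G" for g
  proof -
    have "g [^] (int (order G) * l) = \<one>"
      using g fin by (simp add: int_pow_pow[symmetric] int_pow_int pow_order_eq_1)
    then have "g [^] (n * m) = g [^] (n * m + int (order G) * l)"
      using g by (simp add: int_pow_mult)
    also have "n * m + int (order G) * l = 1" using ml by (simp add: mult.commute)
    finally show ?thesis using g by (simp add: int_pow_pow)
  qed
  then have "inj_on (\<lambda>g. g [^] n) (carrier G)" by (rule inj_on_inverseI)
  moreover have "(\<lambda>g. g [^] n) ` carrier G \<subseteq> carrier G" by auto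
  ultimately show ?thesis
    using fin by (simp add: bij_betw_def endo_inj_surj)
qed

lemma group_algebra_mult_apply:
  fixes u v :: "'a \<Rightarrow> 'f::field"
  assumes "finite (carrier G)"
  shows "(u \<otimes>\<^bsub>group_algebra G\<^esub> v) x =
    (\<Sum>y\<in>carrier G. \<Sum>z\<in>carrier G. if y \<otimes> z = x then u y * v z else 0)"
proof -
  have "(u \<otimes>\<^bsub>group_algebra G\<^esub> v) x =
    (\<Sum>(y, z)\<in>{(y, z). y \<in> carrier G \<and> z \<in> carrier G \<and> y \<otimes> z = x}. u y * v z)"
    by (simp add: group_algebra_def)
  also have "\<dots> = (\<Sum>(y, z)\<in>carrier G \<times> carrier G. if y \<otimes> z = x then u y * v z else 0)"
    using assms by (intro sum.mono_neutral_cong_left) (auto split: if_splits)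
  finally show ?thesis by (simp add: sum.cartesian_product)
qed

text \<open>Expands a coefficient over tuples of group elements, already reparametrized by the
  bijections \<open>\<sigma> i\<close>, so that with power maps the equation from the hypothesis on
  \<open>A\<close> appears as the summation condition.\<close>

lemma list_prod_group_algebra_apply:
  fixes u :: "'i \<Rightarrow> 'a \<Rightarrow> 'f::field"
  assumes fin: "finite (carrier G)" and "distinct js"
    and "\<And>i. i \<in> set js \<Longrightarrow> bij_betw (\<sigma> i) (carrier G) (carrier G)"
  shows "list_prod (group_algebra G) (map u js) x =
    (\<Sum>h\<in>Pi\<^sub>E (set js) (\<lambda>_. carrier G).
      if list_prod G (map (\<lambda>i. \<sigma> i (h i)) js) = x then \<Prod>i\<in>set js. u i (\<sigma> i (h i)) else 0)"
  using assms(2,3)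
proof (induction js arbitrary: x)
  case Nil
  then show ?case by (auto simp: group_algebra_def)
next
  case (Cons j js)
  let ?C = "carrier G" and ?P = "Pi\<^sub>E (set js) (\<lambda>_. carrier G)"
  let ?l = "\<lambda>h. list_prod G (map (\<lambda>i. \<sigma> i (h i)) js)"
  let ?p = "\<lambda>h. \<Prod>i\<in>set js. u i (\<sigma> i (h i))"
  have j: "j \<notin> set js" using Cons.prems by simp
  have l: "?l h \<in> ?C" if "h \<in> ?P" for h
    using that Cons.prems by (intro list_prod_closed) (auto simp: bij_betw_def)
  have IH: "list_prod (group_algebra G) (map u js) z = (\<Sum>h\<in>?P. if ?l h = z then ?p h else 0)" for z
    using Cons.prems by (intro Cons.IH) auto
  have "list_prod (group_algebra G) (map u (j # js)) x =
    (\<Sum>y\<in>?C. \<Sum>z\<in>?C. if y \<otimes> z = x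
      then u j y * (\<Sum>h\<in>?P. if ?l h = z then ?p h else 0) else 0)"
    by (simp add: group_algebra_mult_apply[OF fin] IH cong: if_cong)
  also have "\<dots> = (\<Sum>y\<in>?C. \<Sum>z\<in>?C. \<Sum>h\<in>?P.
      if ?l h = z then if y \<otimes> z = x then u j y * ?p h else 0 else 0)"
    by (intro sum.cong refl) (auto simp: sum_distrib_left intro!: sum.cong sum.neutral)
  \<comment> \<open>With \<open>z\<close> innermost, the condition \<open>?l h = z\<close> collapses
    the sum to one term; \<open>l\<close> places that term in the carrier.\<close>
  also have "\<dots> = (\<Sum>y\<in>?C. \<Sum>h\<in>?P. \<Sum>z\<in>?C.
      if ?l h = z then if y \<otimes> z = x then u j y * ?p h else 0 else 0)"
    by (intro sum.cong refl sum.swap)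
  also have "\<dots> = (\<Sum>y\<in>?C. \<Sum>h\<in>?P. if y \<otimes> ?l h = x then u j y * ?p h else 0)"
    using fin l by (intro sum.cong refl) (simp add: sum.delta)
  also have "\<dots> = (\<Sum>g\<in>?C. \<Sum>h\<in>?P. if \<sigma> j g \<otimes> ?l h = x then u j (\<sigma> j g) * ?p h else 0)"
    using Cons.prems by (intro sum.reindex_bij_betw[symmetric]) auto
  also have "\<dots> = (\<Sum>(g, h)\<in>?C \<times> ?P. if \<sigma> j g \<otimes> ?l h = x then u j (\<sigma> j g) * ?p h else 0)"
    by (simp add: sum.cartesian_product)
  \<comment> \<open>A pair \<open>(g, h)\<close> becomes the tuple \<open>h(j := g)\<close>; as
    \<open>j\<close> is new, the parts for \<open>js\<close> do not change.\<close>
  also have "\<dots> = (\<Sum>h\<in>Pi\<^sub>E (insert j (set js)) (\<lambda>_. ?C).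
      if \<sigma> j (h j) \<otimes> ?l h = x then u j (\<sigma> j (h j)) * ?p h else 0)"
  proof -
    have "?l (h(j := g)) = ?l h" "?p (h(j := g)) = ?p h" for h g
      using j by (auto intro!: prod.cong arg_cong[where f = "list_prod G"])
    moreover have "inj_on (\<lambda>(g, h). h(j := g)) (?C \<times> ?P)" using inj_combinator[OF j] .
    ultimately show ?thesis
      by (simp add: PiE_insert_eq sum.reindex case_prod_unfold cong: if_cong)
  qed
  finally show ?case using j by (simp cong: if_cong)
qed

end

section \<open>Moving the subspaces to functions on \<open>A\<close>\<close>

definition pullback :: "('g, 'm) monoid_scheme \<Rightarrow> ('g \<Rightarrow> 'g) \<Rightarrow> ('g \<Rightarrow> 'f::field) \<Rightarrow> 'g \<Rightarrow> 'f" where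
  "pullback G \<sigma> u = (\<lambda>g. if g \<in> carrier G then u (\<sigma> g) else 0)"

lemma pullback_apply: "pullback G \<sigma> u g = (if g \<in> carrier G then u (\<sigma> g) else 0)"
  by (simp add: pullback_def)

lemma linear_pullback: "Vector_Spaces.linear fscale fscale (pullback G \<sigma>)"
  by (rule linear_funcI) (auto simp: pullback_def fscale_def fun_eq_iff)

text \<open>For a power map \<open>\<sigma>\<close> this is the space \<open>Y\<^sub>i\<close> of
  the overview, kept as functions on the whole type that vanish outside \<open>A\<close>.\<close>

definition pulled_subspace ::
    "('g, 'm) monoid_scheme \<Rightarrow> 'g set \<Rightarrow> ('g \<Rightarrow> 'g) \<Rightarrow> ('g \<Rightarrow> 'f::field) set \<Rightarrow> ('g \<Rightarrow> 'f) set" where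
  "pulled_subspace G A \<sigma> X = {f \<in> pullback G \<sigma> ` X. restr (carrier G - A) f = 0}"

lemma subspace_pulled_subspace:
  assumes "func.subspace X"
  shows "func.subspace (pulled_subspace G A \<sigma> X)"
proof -
  interpret l: Vector_Spaces.linear fscale fscale "restr (carrier G - A)" by (rule linear_restr)
  have "func.subspace (pullback G \<sigma> ` X \<inter> {f. restr (carrier G - A) f = 0})"
    by (intro func.subspace_inter func_subspace_image linear_pullback assms l.subspace_kernel)
  then show ?thesis by (simp add: pulled_subspace_def Int_def)
qed

text \<open>Pullback along a bijection is injective on \<open>X\<close> and so loses no dimension;
  requiring support in \<open>A\<close> then costs at most \<open>card (carrier G - A)\<close>
  dimensions.\<close>

lemma rcodim_pulled_subspace_le_codim:
  fixes X :: "('g \<Rightarrow> 'f::field) set"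
  assumes fin: "finite (carrier G)" and A: "A \<subseteq> carrier G"
    and bij: "bij_betw \<sigma> (carrier G) (carrier G)" and X: "group_algebra_subspace G X"
  shows "rcodim A (pulled_subspace G A \<sigma> X) \<le> codim G X"
proof -
  let ?C = "carrier G" and ?Y = "pulled_subspace G A \<sigma> X"
  have sub: "func.subspace X" and supp: "\<And>u x. u \<in> X \<Longrightarrow> x \<notin> ?C \<Longrightarrow> u x = 0"
    using X by (auto simp: group_algebra_subspace_def group_algebra_def)
  have "v = 0" if v: "v \<in> X" "pullback G \<sigma> v = 0" for v
  proof
    fix x
    show "v x = 0 x"
    proof (cases "x \<in> ?C")
      case True
      then obtain g where "g \<in> ?C" "x = \<sigma> g" using bij by (auto simp: bij_betw_def)
      then show ?thesis using fun_cong[OF v(2), of g] by (simp add: pullback_def)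
    qed (use supp v in simp)
  qed
  then have "func.dim {v \<in> X. pullback G \<sigma> v = 0} = 0" by (intro func_dim_eq_0) blast
  then have "func.dim X \<le> func.dim (pullback G \<sigma> ` X)"
    using func_dim_le_image_plus_kernel[of "pullback G \<sigma>" X ?C ?C] linear_pullback[of G \<sigma>] sub fin supp
    by (simp add: pullback_apply)
  also have "\<dots> \<le> func.dim (restr (?C - A) ` pullback G \<sigma> ` X) + func.dim ?Y"
    unfolding pulled_subspace_def
    by (rule func_dim_le_image_plus_kernel[OF linear_restr func_subspace_image[OF linear_pullback sub]
          fin _ fin]) (auto simp: pullback_def restr_def)
  also have "func.dim (restr (?C - A) ` pullback G \<sigma> ` X) \<le> card (?C - A)"
    using fin by (intro func_dim_le_card) (auto simp: restr_def)
  finally have "func.dim X \<le> card (?C - A) + func.dim ?Y" by simp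
  \<comment> \<open>The elements already vanish outside \<open>A\<close>, so
    \<open>rdim A ?Y\<close> is the full dimension.\<close>
  moreover have "restr A ` ?Y = ?Y"
  proof -
    have "restr A f = f" if f: "f \<in> ?Y" for f
    proof
      fix x
      have "restr (?C - A) f x = 0" "x \<notin> ?C \<Longrightarrow> f x = 0"
        using f by (auto simp: pulled_subspace_def pullback_apply)
      then show "restr A f x = f x" by (auto simp: restr_apply split: if_splits)
    qed
    then show ?thesis by simp
  qed
  moreover have "card (?C - A) + card A = order G"
    using fin A by (metis card_Diff_subset card_mono finite_subset le_add_diff_inverse2 order_def)
  ultimately show ?thesis by (simp add: rcodim_def rdim_def codim_def)
qed

text \<open>Compare the coefficient of \<open>\<one>\<close> on both sides of the vanishing product.
  Tuples leaving \<open>A\<close> contribute zero, those within \<open>A\<close> with product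
  \<open>\<one>\<close> are constant by \<open>solfree\<close>, and every constant tuple has product
  \<open>\<one>\<close> because the exponents sum to 0.\<close>

lemma (in group) sum_prod_pulled_subspaces:
  fixes X :: "nat \<Rightarrow> ('a \<Rightarrow> 'f::field) set"
  assumes fin: "finite (carrier G)" and k: "k \<ge> 1"
    and n: "(\<Sum>i=1..k. n i) = (0::int)"
    and bij: "\<And>i. i \<in> {1..k} \<Longrightarrow> bij_betw (\<lambda>g. g [^] n i) (carrier G) (carrier G)"
    and A: "A \<subseteq> carrier G"
    and solfree: "\<And>g :: nat \<Rightarrow> 'a. \<lbrakk>\<forall>i\<in>{1..k}. g i \<in> A;
            list_prod G (map (\<lambda>i. g i [^] n i) [1..<Suc k]) = \<one>\<rbrakk>
          \<Longrightarrow> \<forall>i\<in>{1..k}. \<forall>j\<in>{1..k}. g i = g j"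
    and vanish: "product_vanishes G k X"
    and f: "\<And>i. i \<in> {1..k} \<Longrightarrow> f i \<in> pulled_subspace G A (\<lambda>g. g [^] n i) (X i)"
  shows "(\<Sum>a\<in>A. \<Prod>i\<in>{1..k}. f i a) = 0"
proof -
  let ?K = "{1..k}" and ?l = "\<lambda>h. list_prod G (map (\<lambda>i. h i [^] n i) [1..<Suc k])"
  have setK: "set [1..<Suc k] = ?K" by auto
  have "\<forall>i\<in>?K. \<exists>u\<in>X i. f i = pullback G (\<lambda>g. g [^] n i) u"
    using f unfolding pulled_subspace_def by blast
  then obtain u where u: "\<And>i. i \<in> ?K \<Longrightarrow> u i \<in> X i"
    "\<And>i. i \<in> ?K \<Longrightarrow> f i = pullback G (\<lambda>g. g [^] n i) (u i)" by metis
  have uf: "u i (g [^] n i) = f i g" if "i \<in> ?K" "g \<in> carrier G" for i g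
    using u(2)[OF that(1)] that(2) by (simp add: pullback_def)
  have f0: "f i g = 0" if "i \<in> ?K" "g \<in> carrier G" "g \<notin> A" for i g
  proof -
    have "restr (carrier G - A) (f i) g = 0" using f[OF that(1)] by (simp add: pulled_subspace_def)
    then show ?thesis using that by (simp add: restr_def)
  qed
  have "list_prod (group_algebra G) (map u [1..<Suc k]) = \<zero>\<^bsub>group_algebra G\<^esub>"
    using vanish u(1) by (simp add: product_vanishes_def)
  then have "0 = list_prod (group_algebra G) (map u [1..<Suc k]) \<one>"
    by (simp add: group_algebra_def)
  also have "\<dots> = (\<Sum>h\<in>Pi\<^sub>E ?K (\<lambda>_. carrier G). if ?l h = \<one> then \<Prod>i\<in>?K. u i (h i [^] n i) else 0)"
    by (rule list_prod_group_algebra_apply[OF fin distinct_upt[of 1 "Suc k"],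
          where \<sigma> = "\<lambda>i g. g [^] n i" and u = u and x = \<one>, unfolded setK]) (rule bij)
  also have "\<dots> = (\<Sum>h\<in>Pi\<^sub>E ?K (\<lambda>_. carrier G). if ?l h = \<one> then \<Prod>i\<in>?K. f i (h i) else 0)"
    by (intro sum.cong refl if_cong prod.cong) (auto simp: uf PiE_iff)
  also have "\<dots> = (\<Sum>h\<in>(\<lambda>a. \<lambda>i\<in>?K. a) ` A. \<Prod>i\<in>?K. f i (h i))"
  proof (intro sum.mono_neutral_cong_right ballI)
    show "finite (Pi\<^sub>E ?K (\<lambda>_. carrier G))" using fin by (simp add: finite_PiE)
    show "(\<lambda>a. \<lambda>i\<in>?K. a) ` A \<subseteq> Pi\<^sub>E ?K (\<lambda>_. carrier G)" using A by auto
  next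
    fix h assume h: "h \<in> Pi\<^sub>E ?K (\<lambda>_. carrier G) - (\<lambda>a. \<lambda>i\<in>?K. a) ` A"
    show "(if ?l h = \<one> then \<Prod>i\<in>?K. f i (h i) else 0) = 0"
    proof (cases "\<forall>i\<in>?K. h i \<in> A")
      case True
      have "?l h \<noteq> \<one>"
      proof
        assume one: "?l h = \<one>"
        have K1: "1 \<in> ?K" using k by simp
        then have eq: "h i = h 1" if "i \<in> ?K" for i using solfree[OF True one] that by blast
        have "h = (\<lambda>i\<in>?K. h 1)"
        proof (rule extensionalityI[of _ ?K])
          show "h \<in> extensional ?K" using h by (simp add: PiE_def)
          show "h i = (\<lambda>i\<in>?K. h 1) i" if "i \<in> ?K" for i
            using eq[OF that] that by (simp only: restrict_apply if_True)
        qed simp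
        moreover have "h 1 \<in> A" using True K1 by blast
        ultimately show False using h by blast
      qed
      then show ?thesis by simp
    next
      case False
      then obtain i where i: "i \<in> ?K" "h i \<notin> A" by blast
      then have "f i (h i) = 0" using h by (intro f0) (auto simp: PiE_def)
      then have "(\<Prod>i\<in>?K. f i (h i)) = 0" using i(1) by (intro prod_zero) auto
      then show ?thesis by simp
    qed
  next
    fix h assume "h \<in> (\<lambda>a. \<lambda>i\<in>?K. a) ` A"
    then obtain a where a: "a \<in> A" "h = (\<lambda>i\<in>?K. a)" by blast
    have "?l h = list_prod G (map (\<lambda>i. a [^] n i) [1..<Suc k])"
      using a by (intro arg_cong[where f = "list_prod G"] map_cong) auto
    also have "\<dots> = a [^] (\<Sum>i\<leftarrow>[1..<Suc k]. n i)" using a A by (intro list_prod_int_pow) auto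
    also have "(\<Sum>i\<leftarrow>[1..<Suc k]. n i) = (\<Sum>i\<in>?K. n i)"
      by (metis distinct_upt setK sum_list_distinct_conv_sum_set)
    finally show "(if ?l h = \<one> then \<Prod>i\<in>?K. f i (h i) else 0) = (\<Prod>i\<in>?K. f i (h i))"
      using n by simp
  qed
  also have "\<dots> = (\<Sum>a\<in>A. \<Prod>i\<in>?K. f i a)"
  \<comment> \<open>Index 1 exists since \<open>k \<ge> 1\<close>, and evaluating there recovers
    \<open>a\<close> from its constant tuple.\<close>
  proof (subst sum.reindex)
    show "inj_on (\<lambda>a. \<lambda>i\<in>?K. a) A"
    proof (rule inj_onI)
      fix a b assume "(\<lambda>i\<in>?K. a) = (\<lambda>i\<in>?K. b)"
      from fun_cong[OF this, of 1] k show "a = b" by simp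
    qed
  qed (auto intro!: sum.cong prod.cong)
  finally show ?thesis by simp
qed

section \<open>Representatives of the index classes and the final bounds\<close>

lemma maximal_nonequiv_system_covers:
  assumes "maximal_nonequiv_system k X n I" "i \<in> {1..k}"
  obtains j where "j \<in> I" "X i = X j" "n i = n j"
proof (cases "i \<in> I")
  case False
  then have "\<not> nonequiv_system k X n (insert i I)"
    using assms(1) by (auto simp: maximal_nonequiv_system_def)
  then obtain j where "j \<in> I" "index_equiv X n i j \<or> index_equiv X n j i"
    using assms by (auto simp: maximal_nonequiv_system_def nonequiv_system_def)
  then show ?thesis using that by (metis index_equiv_def)
qed (use that in blast)

theorem theorem2:
  fixes G :: "('g, 'm) monoid_scheme" (structure)
    and k :: nat
    and n :: "nat \<Rightarrow> int"
    and A :: "'g set"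
    and X :: "nat \<Rightarrow> ('g \<Rightarrow> 'f::field) set"
  assumes "group G" and "finite (carrier G)"
    and "k \<ge> 2"
    and "\<And>i. i \<in> {1..k} \<Longrightarrow> n i \<noteq> 0"
    and "(\<Sum>i=1..k. n i) = 0"
    and "\<And>i. i \<in> {1..k} \<Longrightarrow> coprime (n i) (int (order G))"
    and "A \<subseteq> carrier G"
    and "\<And>g :: nat \<Rightarrow> 'g. \<lbrakk>\<forall>i\<in>{1..k}. g i \<in> A;
            list_prod G (map (\<lambda>i. g i [^]\<^bsub>G\<^esub> n i) [1..<Suc k]) = \<one>\<^bsub>G\<^esub>\<rbrakk>
          \<Longrightarrow> \<forall>i\<in>{1..k}. \<forall>j\<in>{1..k}. g i = g j"
    and "\<And>i. i \<in> {1..k} \<Longrightarrow> group_algebra_subspace G (X i)"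
    and "product_vanishes G k X"
  shows "(\<forall>I. maximal_nonequiv_system k X n I \<longrightarrow>
            (card I \<ge> 2 \<longrightarrow> int (card A) \<le> (\<Sum>i\<in>I. codim G (X i))) \<and>
            (card I = 1 \<longrightarrow> int (card A) \<le> 2 * codim G (X 1)))
         \<and> int (card A) \<le> (\<Sum>i=1..k. codim G (X i))"
proof -
  interpret group G by fact
  let ?K = "{1..k}"
  let ?Y = "\<lambda>i. pulled_subspace G A (\<lambda>g. g [^] n i) (X i)"
  have bij: "bij_betw (\<lambda>g. g [^] n i) (carrier G) (carrier G)" if "i \<in> ?K" for i
    using assms(2) assms(6)[OF that] by (rule bij_betw_int_pow)
  have vanish: "(\<Sum>a\<in>A. \<Prod>i\<in>?K. f i a) = 0" if "\<And>i. i \<in> ?K \<Longrightarrow> f i \<in> ?Y i" for f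
    by (rule sum_prod_pulled_subspaces[OF assms(2) _ assms(5) bij assms(7,8,10) that])
      (use assms(3) in simp)
  \<comment> \<open>Here \<open>I\<close> need only have two elements and meet every class; its
    members may be equivalent. This one bound serves a maximal system, the pair
    \<open>{1, 2}\<close> and all of \<open>?K\<close>.\<close>
  have bound: "int (card A) \<le> (\<Sum>i\<in>I. codim G (X i))"
    if I: "I \<subseteq> ?K" "card I \<ge> 2" "\<And>i. i \<in> ?K \<Longrightarrow> \<exists>j\<in>I. X i = X j \<and> n i = n j" for I
  proof -
    have "finite I" using I(1) finite_subset by blast
    then obtain p q where pq: "p \<in> I" "q \<in> I" "p \<noteq> q"
      using I(2) card_le_Suc0_iff_eq[of I] by fastforce
    have "int (card A) \<le> (\<Sum>i\<in>I. rcodim A (?Y i))"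
    proof (rule card_le_sum_rcodim[OF _ _ I(1) _ _ pq vanish])
      show "finite A" using assms(2,7) finite_subset by blast
      show "func.subspace (?Y i)" if "i \<in> ?K" for i
        using assms(9)[OF that] by (simp add: subspace_pulled_subspace group_algebra_subspace_def)
      \<comment> \<open>The pulled back space depends on \<open>i\<close> only through
        \<open>X i\<close> and \<open>n i\<close>, which is what equivalence compares.\<close>
      show "\<exists>j\<in>I. ?Y i = ?Y j" if "i \<in> ?K" for i
        using I(3)[OF that] by metis
    qed auto
    also have "\<dots> \<le> (\<Sum>i\<in>I. codim G (X i))"
      using I(1) assms(2,7,9) bij by (intro sum_mono rcodim_pulled_subspace_le_codim) auto
    finally show ?thesis .
  qed
  have one: "int (card A) \<le> 2 * codim G (X 1)"
    if max: "maximal_nonequiv_system k X n I" and card: "card I = 1" for I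
  proof -
    obtain i0 where I: "I = {i0}" using card by (auto simp: card_1_singleton_iff)
    have eq: "X i = X i0 \<and> n i = n i0" if "i \<in> ?K" for i
      using maximal_nonequiv_system_covers[OF max that] I by auto
    have 1: "1 \<in> ?K" and 2: "2 \<in> ?K" using assms(3) by auto
    \<comment> \<open>A single class offers only one representative where two are needed, so it is
      counted twice through the equivalent indices 1 and 2.\<close>
    have "int (card A) \<le> (\<Sum>i\<in>{1, 2}. codim G (X i))"
    proof (rule bound)
      show "\<exists>j\<in>{1, 2}. X i = X j \<and> n i = n j" if "i \<in> ?K" for i
        using eq[OF that] eq[OF 1] by auto
    qed (use 1 2 in auto)
    also have "\<dots> = 2 * codim G (X 1)" using eq[OF 1] eq[OF 2] by simp
    finally show ?thesis .
  qed
  have many: "int (card A) \<le> (\<Sum>i\<in>I. codim G (X i))"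
    if max: "maximal_nonequiv_system k X n I" and card: "card I \<ge> 2" for I
  proof (rule bound)
    show "I \<subseteq> ?K" using max by (simp add: maximal_nonequiv_system_def nonequiv_system_def)
    show "\<exists>j\<in>I. X i = X j \<and> n i = n j" if "i \<in> ?K" for i
      using maximal_nonequiv_system_covers[OF max that] by metis
  qed (rule card)
  have all: "int (card A) \<le> (\<Sum>i\<in>?K. codim G (X i))"
    using assms(3) by (intro bound) auto
  show ?thesis by (intro conjI allI impI one many all)
qed

end
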